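(* Let $\mathcal{C}$ be a simple Chain Event Graph (sCEG) and let $w_1,w_2\in V(\mathcal{C})\setminus\{w_\infty\}$ with $w_2\not\prec w_1$. Then $X(w_1)\amalg X(w_2)$ if and only if either (i) there exists a cut-vertex $w$ of $\mathcal{C}$ such that $w_1\prec w\prec w_2$, or (ii) $w_2$ is itself a cut-vertex of $\mathcal{C}$.
   Context: **sCEG.** A simple Chain Event Graph (sCEG) $\mathcal{C}$ is a finite directed acyclic graph, in which several parallel edges between two vertices are allowed, with a unique root $w_0$ (no incoming edges) and a unique sink $w_\infty\neq w_0$ (no outgoing edges), so that every vertex and edge lies on a directed path from $w_0$ to $w_\infty$. Its vertex set is $V(\mathcal{C})$, and vertices other than $w_\infty$ are called positions. A directed $w_0\to w_\infty$ path (a sequence of edges) is called a route and denoted $\lambda$; the finite set of routes $\Lambda(\mathcal{C})$ is the sample space (routes are the atoms). Write $w\in\lambda$ or $e\in\lambda$ if the position $w$ or edge $e$ lies on $\lambda$. Each edge $e(w,w')$ carries a probability $\pi_e(w'\mid w)$, and $p(\lambda)=\prod_{e(w,w')\in\lambda}\pi_e(w'\mid w)$. In an sCEG there are no constraints on edge-probabilities except that (a) all are strictly greater than zero and (b) the probabilities of the edges leaving any given position sum to one. A probability distribution on $\Lambda(\mathcal{C})$ arising from any such choice of edge-probabilities is said to be compatible with $\mathcal{C}$. **Order.** $w\prec w'$ means that $w$ precedes $w'$ on some route. **Position variables.** For each position $w$, the edges leaving $w$ are labelled $e_x(w)$ with distinct positive integers $x=1,2,\dots$. The random variable $X(w)$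 on $\Lambda(\mathcal{C})$ is defined by $X(w)(\lambda)=x$ if $e_x(w)\in\lambda$, and $X(w)(\lambda)=0$ if $w\notin\lambda$. **Independence.** $X\amalg Y$ means that $p(X=x,Y=y)=p(X=x)\,p(Y=y)$ for all values $x,y$, and that this holds for all distributions compatible with $\mathcal{C}$. **Cut-vertex.** A position $w\in V(\mathcal{C})\setminus\{w_\infty\}$ is a cut-vertex if the removal of $w$ and its associated edges from $\mathcal{C}$ would result in a graph with two disconnected components; alternatively described, a cut-vertex is a position other than $w_0$ through which all routes pass.
   Formalization: The positions w_1 and w_2 are assumed distinct; for w_1 = w_2 the claim fails, e.g. when w_1 = w_2 is a cut-vertex with two outgoing edges, where (ii) holds but X(w_1) is not independent of itself. *)

theory Defs
  imports "Graph_Theory.Digraph_Component" "HOL-Probability.Probability_Mass_Function"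
begin

text \<open>
  A multi-digraph (\<^typ>\<open>('a,'b) pre_digraph\<close>) allows parallel arcs; walks are lists of arcs.
  Acyclicity is the absence of any \<^const>\<open>pre_digraph.cycle\<close>, which also excludes loops.
\<close>

definition routes :: "('a,'b) pre_digraph \<Rightarrow> 'a \<Rightarrow> 'a \<Rightarrow> 'b list set" where
  "routes C w0 winf = {l. pre_digraph.awalk C w0 l winf}"

definition on_route :: "('a,'b) pre_digraph \<Rightarrow> 'a \<Rightarrow> 'a \<Rightarrow> 'b list \<Rightarrow> bool" where
  "on_route C w0 w l \<longleftrightarrow> w \<in> set (pre_digraph.awalk_verts C w0 l)"

locale sceg = fin_digraph C for C :: "('a,'b) pre_digraph" +
  fixes w0 winf :: 'a
  assumes acyclic: "\<nexists>p. cycle p"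
    and w0_in_verts: "w0 \<in> verts C"
    and winf_in_verts: "winf \<in> verts C"
    and w0_neq_winf: "w0 \<noteq> winf"
    and unique_root: "\<And>v. v \<in> verts C \<Longrightarrow> in_arcs C v = {} \<longleftrightarrow> v = w0"
    and unique_sink: "\<And>v. v \<in> verts C \<Longrightarrow> out_arcs C v = {} \<longleftrightarrow> v = winf"
    and vert_on_route: "\<And>v. v \<in> verts C \<Longrightarrow> \<exists>l\<in>routes C w0 winf. on_route C w0 v l"
    and arc_on_route: "\<And>e. e \<in> arcs C \<Longrightarrow> \<exists>l\<in>routes C w0 winf. e \<in> set l"

definition positions :: "('a,'b) pre_digraph \<Rightarrow> 'a \<Rightarrow> 'a set" where
  "positions C winf = verts C - {winf}"

definition precedes :: "('a,'b) pre_digraph \<Rightarrow> 'a \<Rightarrow> 'a \<Rightarrow> 'a \<Rightarrow> 'a \<Rightarrow> bool" where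
  "precedes C w0 winf w w' \<longleftrightarrow> (\<exists>l\<in>routes C w0 winf. \<exists>i j. i < j \<and>
     j < length (pre_digraph.awalk_verts C w0 l) \<and>
     pre_digraph.awalk_verts C w0 l ! i = w \<and> pre_digraph.awalk_verts C w0 l ! j = w')"

definition edge_probabilities :: "('a,'b) pre_digraph \<Rightarrow> 'a \<Rightarrow> ('b \<Rightarrow> real) \<Rightarrow> bool" where
  "edge_probabilities C winf q \<longleftrightarrow>
     (\<forall>e\<in>arcs C. q e > 0) \<and> (\<forall>w\<in>positions C winf. (\<Sum>e\<in>out_arcs C w. q e) = 1)"

definition compatible_with ::
    "('a,'b) pre_digraph \<Rightarrow> 'a \<Rightarrow> 'a \<Rightarrow> 'b list pmf \<Rightarrow> bool" where
  "compatible_with C w0 winf P \<longleftrightarrow> set_pmf P \<subseteq> routes C w0 winf \<and>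
     (\<exists>q. edge_probabilities C winf q \<and>
          (\<forall>l\<in>routes C w0 winf. pmf P l = prod_list (map q l)))"

definition edge_labelling :: "('a,'b) pre_digraph \<Rightarrow> 'a \<Rightarrow> ('b \<Rightarrow> nat) \<Rightarrow> bool" where
  "edge_labelling C winf lab \<longleftrightarrow>
     (\<forall>w\<in>positions C winf. inj_on lab (out_arcs C w) \<and> (\<forall>e\<in>out_arcs C w. lab e > 0))"

text \<open>
  Since the graph is acyclic, a route through a position \<open>w\<close> contains exactly one arc leaving
  \<open>w\<close>, so the description below is well defined on routes.
\<close>

definition position_var ::
    "('a,'b) pre_digraph \<Rightarrow> 'a \<Rightarrow> ('b \<Rightarrow> nat) \<Rightarrow> 'a \<Rightarrow> 'b list \<Rightarrow> nat" where
  "position_var C w0 lab w l =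
     (if on_route C w0 w l then lab (THE e. e \<in> out_arcs C w \<and> e \<in> set l) else 0)"

definition indep ::
    "('a,'b) pre_digraph \<Rightarrow> 'a \<Rightarrow> 'a \<Rightarrow> ('b list \<Rightarrow> nat) \<Rightarrow> ('b list \<Rightarrow> nat) \<Rightarrow> bool" where
  "indep C w0 winf X Y \<longleftrightarrow> (\<forall>P. compatible_with C w0 winf P \<longrightarrow>
     (\<forall>x y. measure_pmf.prob P {l. X l = x \<and> Y l = y} =
            measure_pmf.prob P {l. X l = x} * measure_pmf.prob P {l. Y l = y}))"

text \<open>
  The components of a digraph, with arc directions ignored, are the strongly connected components
  of its symmetric closure.
\<close>

definition weak_components :: "('a,'b) pre_digraph \<Rightarrow> 'a set set" where
  "weak_components G = pre_digraph.sccs_verts (with_proj (mk_symmetric G))"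

definition cut_vertex :: "('a,'b) pre_digraph \<Rightarrow> 'a \<Rightarrow> 'a \<Rightarrow> bool" where
  "cut_vertex C winf w \<longleftrightarrow> w \<in> positions C winf \<and>
     card (weak_components (pre_digraph.del_vert C w)) = 2"

text \<open>The equivalent description of cut-vertices in terms of routes.\<close>

context sceg
begin

lemma walk_from_root_to_sink:
  assumes "u \<in> verts C"
  shows "\<exists>p. awalk w0 p u" "\<exists>p. awalk u p winf"
proof -
  obtain l where "awalk w0 l winf" "u \<in> set (awalk_verts w0 l)"
    using vert_on_route[OF assms] by (auto simp: routes_def on_route_def)
  then show "\<exists>p. awalk w0 p u" "\<exists>p. awalk u p winf"
    using awalk_decomp by blast+
qed

lemma walk_antisym:
  assumes "awalk u p v" "awalk v q u"
  shows "u = v"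
proof (rule ccontr)
  assume "u \<noteq> v"
  then have "p \<noteq> []" using assms by (auto simp: awalk_def)
  moreover have "awalk u (p @ q) u" using assms by auto
  ultimately have "closed_w (p @ q)" by (auto simp: closed_w_def)
  then show False using closed_w_imp_cycle acyclic by blast
qed

lemma walk_avoiding:
  assumes "awalk u p v" "w \<notin> set (awalk_verts u p)"
  shows "u \<rightarrow>\<^sup>*\<^bsub>with_proj (mk_symmetric (del_vert w))\<^esub> v"
proof -
  interpret D: wf_digraph "del_vert w" by (rule wf_digraph_del_vert)
  have "u \<rightarrow>\<^sup>*\<^bsub>del_vert w\<^esub> v" using assms
  proof (induction p arbitrary: u)
    case Nil
    then show ?case by (auto simp: awalk_Nil_iff del_vert_simps)
  next
    case (Cons e p)
    have e: "e \<in> arcs C" "tail C e = u" "awalk (head C e) p v"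
      using Cons.prems by (auto simp: awalk_Cons_iff)
    have "head C e \<noteq> w"
      using Cons.prems(2) by (cases p) (auto simp: e(3), use e(3) in \<open>auto simp: awalk_Cons_iff\<close>)
    then have "u \<rightarrow>\<^bsub>del_vert w\<^esub> head C e"
      using e Cons.prems(2) by (auto simp: arcs_ends_conv del_vert_simps)
    moreover have "head C e \<rightarrow>\<^sup>*\<^bsub>del_vert w\<^esub> v" using Cons e by auto
    ultimately show ?case by (rule D.adj_reachable_trans)
  qed
  then show ?thesis by (rule D.reachable_mk_symmetricI)
qed

lemma cut_vertex_iff_on_all_routes:
  "cut_vertex C winf w \<longleftrightarrow>
     w \<in> positions C winf \<and> w \<noteq> w0 \<and> (\<forall>l\<in>routes C w0 winf. on_route C w0 w l)"
proof (cases "w \<in> positions C winf")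
  case False
  then show ?thesis by (simp add: cut_vertex_def)
next
  case True
  then have w: "w \<in> verts C" "w \<noteq> winf" by (auto simp: positions_def)
  define H where "H = with_proj (mk_symmetric (del_vert w))"
  interpret D: wf_digraph "del_vert w" by (rule wf_digraph_del_vert)
  interpret P: pair_wf_digraph "mk_symmetric (del_vert w)" ..
  have H: "wf_digraph H" unfolding H_def by (rule P.wf_digraph)
  interpret H: wf_digraph H by (rule H)
  have verts_H: "verts H = verts C - {w}"
    by (simp add: H_def del_vert_simps)
  have sym: "u \<rightarrow>\<^sup>*\<^bsub>H\<^esub> v \<Longrightarrow> v \<rightarrow>\<^sup>*\<^bsub>H\<^esub> u" for u v
    unfolding H_def by (rule symmetric_reachable[OF symmetric_mk_symmetric])
  have avoid: "u \<rightarrow>\<^sup>*\<^bsub>H\<^esub> v" if "awalk u p v" "w \<notin> set (awalk_verts u p)" for u p v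
    using walk_avoiding[OF that] by (simp add: H_def)
  have comps: "weak_components (del_vert w) = H.sccs_verts"
    by (simp add: weak_components_def H_def)
  have up_or_down: "w0 \<rightarrow>\<^sup>*\<^bsub>H\<^esub> u \<or> winf \<rightarrow>\<^sup>*\<^bsub>H\<^esub> u" if u: "u \<in> verts H" for u
  proof -
    have uw: "u \<in> verts C" "u \<noteq> w" using u verts_H by auto
    obtain p q where p: "awalk w0 p u" and q: "awalk u q winf"
      using walk_from_root_to_sink[OF uw(1)] by blast
    have "w \<notin> set (awalk_verts w0 p) \<or> w \<notin> set (awalk_verts u q)"
    proof (rule ccontr)
      assume "\<not> ?thesis"
      then obtain p' q' where "awalk w p' u" "awalk u q' w"
        using awalk_decomp[OF p, of w] awalk_decomp[OF q, of w] by blast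
      then show False using walk_antisym uw(2) by blast
    qed
    then show ?thesis using avoid[OF p] avoid[OF q] sym by blast
  qed
  have one: "card H.sccs_verts \<noteq> 2" if z: "\<And>u. u \<in> verts H \<Longrightarrow> z \<rightarrow>\<^sup>*\<^bsub>H\<^esub> u" for z
  proof
    have zmem: "z \<in> S" if S: "S \<in> H.sccs_verts" for S
    proof -
      obtain u where u: "u \<in> S" "u \<rightarrow>\<^sup>*\<^bsub>H\<^esub> u"
        using S by (auto simp: H.in_sccs_verts_conv_reachable)
      then have "z \<rightarrow>\<^sup>*\<^bsub>H\<^esub> u" using z H.reachable_in_verts by blast
      with u(1) S sym show ?thesis unfolding H.in_sccs_verts_conv_reachable by blast
    qed
    assume "card H.sccs_verts = 2"
    then obtain S T where "S \<in> H.sccs_verts" "T \<in> H.sccs_verts" "S \<noteq> T"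
      by (auto simp: card_2_iff)
    then show False using H.sccs_verts_disjoint zmem by blast
  qed
  have "card H.sccs_verts = 2 \<longleftrightarrow> w \<noteq> w0 \<and> (\<forall>l\<in>routes C w0 winf. on_route C w0 w l)"
  proof (intro iffI conjI)
    assume c: "card H.sccs_verts = 2"
    show "w \<noteq> w0"
    proof
      assume eq: "w = w0"
      have "winf \<rightarrow>\<^sup>*\<^bsub>H\<^esub> u" if "u \<in> verts H" for u
        using up_or_down[OF that] eq verts_H H.reachable_in_verts by blast
      then show False using one c by blast
    qed
    show "\<forall>l\<in>routes C w0 winf. on_route C w0 w l"
    proof (rule ccontr)
      assume "\<not> ?thesis"
      then have "w0 \<rightarrow>\<^sup>*\<^bsub>H\<^esub> winf" using avoid by (auto simp: routes_def on_route_def)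
      then have "w0 \<rightarrow>\<^sup>*\<^bsub>H\<^esub> u" if "u \<in> verts H" for u
        using up_or_down[OF that] H.reachable_trans by blast
      then show False using one c by blast
    qed
  next
    assume a: "w \<noteq> w0 \<and> (\<forall>l\<in>routes C w0 winf. on_route C w0 w l)"
    define A where "A = {u. \<exists>p. awalk u p w}"
    have step: "tail C e \<in> A \<longleftrightarrow> head C e \<in> A"
      if e: "e \<in> arcs C" "tail C e \<noteq> w" "head C e \<noteq> w" for e
    proof
      assume "head C e \<in> A"
      then obtain p where "awalk (head C e) p w" by (auto simp: A_def)
      then have "awalk (tail C e) (e # p) w" using e by (auto simp: awalk_Cons_iff)
      then show "tail C e \<in> A" by (auto simp: A_def)
    next
      assume t: "tail C e \<in> A"
      show "head C e \<in> A"
      proof (rule ccontr)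
        assume h: "head C e \<notin> A"
        obtain p q where p: "awalk w0 p (tail C e)" and q: "awalk (head C e) q winf"
          using walk_from_root_to_sink e(1) by (meson head_in_verts tail_in_verts)
        have 1: "w \<notin> set (awalk_verts w0 p)"
        proof
          assume "w \<in> set (awalk_verts w0 p)"
          then obtain p' where "awalk w p' (tail C e)" using awalk_decomp[OF p] by blast
          then show False using t walk_antisym e(2) by (auto simp: A_def)
        qed
        have 2: "w \<notin> set (awalk_verts (head C e) q)"
          using awalk_decomp[OF q, of w] h by (auto simp: A_def)
        have eq: "awalk (tail C e) (e # q) winf"
          using q e by (auto simp: awalk_Cons_iff)
        have r: "awalk w0 (p @ e # q) winf" using p eq by (rule awalk_appendI)
        then have "w \<in> set (awalk_verts w0 (p @ e # q))"
          using a by (auto simp: routes_def on_route_def)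
        then show False using 1 2 e(2) r set_awalk_verts_append[OF p eq] by auto
      qed
    qed
    have inv: "u \<in> A \<longleftrightarrow> v \<in> A" if "u \<rightarrow>\<^sup>*\<^bsub>H\<^esub> v" for u v
      using that
    proof (induction rule: H.reachable_induct)
      case base
      show ?case ..
    next
      case (step x y)
      have "(x, y) \<in> parcs (mk_symmetric (del_vert w))"
        using step.hyps by (simp add: H_def)
      then have "x \<in> A \<longleftrightarrow> y \<in> A"
        using \<open>\<And>e. \<lbrakk>e \<in> arcs C; tail C e \<noteq> w; head C e \<noteq> w\<rbrakk>
            \<Longrightarrow> tail C e \<in> A \<longleftrightarrow> head C e \<in> A\<close>
        by (auto simp: parcs_mk_symmetric del_vert_simps)
      then show ?case using step.IH by blast
    qed
    have "w0 \<in> A" using walk_from_root_to_sink(1)[OF w(1)] by (auto simp: A_def)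
    moreover have "winf \<notin> A"
      using walk_from_root_to_sink(2)[OF w(1)] walk_antisym w(2) by (auto simp: A_def)
    ultimately have sep: "\<not> w0 \<rightarrow>\<^sup>*\<^bsub>H\<^esub> winf" using inv by blast
    define comp where "comp u = {v. u \<rightarrow>\<^sup>*\<^bsub>H\<^esub> v}" for u
    have refl: "w0 \<in> comp w0" "winf \<in> comp winf"
      using a w w0_in_verts winf_in_verts verts_H by (auto simp: comp_def)
    have sccI: "comp u \<in> H.sccs_verts" if "u \<in> comp u" for u
    proof -
      have "x \<rightarrow>\<^sup>*\<^bsub>H\<^esub> y" if "x \<in> comp u" "y \<in> comp u" for x y
      proof -
        have "x \<rightarrow>\<^sup>*\<^bsub>H\<^esub> u" "u \<rightarrow>\<^sup>*\<^bsub>H\<^esub> y"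
          using that sym by (auto simp: comp_def)
        then show ?thesis by (rule H.reachable_trans)
      qed
      moreover have "\<not> x \<rightarrow>\<^sup>*\<^bsub>H\<^esub> y" if "x \<in> comp u" "y \<notin> comp u" for x y
        using that H.reachable_trans[of u x y] by (auto simp: comp_def)
      ultimately show ?thesis
        using that unfolding H.in_sccs_verts_conv_reachable by blast
    qed
    have "S = comp w0 \<or> S = comp winf" if S: "S \<in> H.sccs_verts" for S
    proof -
      obtain u where u: "u \<in> S" "u \<rightarrow>\<^sup>*\<^bsub>H\<^esub> u"
        using S by (auto simp: H.in_sccs_verts_conv_reachable)
      then have "u \<in> comp w0 \<or> u \<in> comp winf"
        using up_or_down H.reachable_in_verts by (auto simp: comp_def)
      then show ?thesis
        using H.sccs_verts_disjoint[OF S sccI[OF refl(1)]]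
          H.sccs_verts_disjoint[OF S sccI[OF refl(2)]] u(1) by blast
    qed
    then have "H.sccs_verts = {comp w0, comp winf}" using sccI refl by blast
    moreover have "comp w0 \<noteq> comp winf" using refl sep by (auto simp: comp_def)
    ultimately show "card H.sccs_verts = 2" by simp
  qed
  then show ?thesis using True by (simp add: cut_vertex_def comps)
qed

end

end

theory Submission
  imports Defs
begin

text \<open>
  Write \<open>W u v\<close> for the total probability weight of the walks from \<open>u\<close> to \<open>v\<close>. Comparing the events
  that a route uses an arc \<open>e\<close> out of \<open>w1\<close> and an arc out of \<open>w2\<close>, independence forces
  \<open>W (head e) w2 = W w0 w2\<close> for every choice of edge probabilities. If \<open>W a z = W b z\<close> for every
  choice, then one vertex lies on all walks from \<open>a\<close> or \<open>b\<close> to \<open>z\<close> or the sink: one of the two, say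
  \<open>a\<close>, is not reachable from \<open>b\<close>, so by varying the probabilities at \<open>a\<close> the identity is inherited
  by each pair of a successor of \<open>a\<close> and \<open>b\<close>, and the last of the vertices that separate \<open>b\<close>
  serves for all these pairs at once. For \<open>head e\<close> and \<open>w0\<close> this vertex is the required cut-vertex.
  Conversely, cutting the routes at a cut-vertex splits their distribution into a product.
\<close>

subsection \<open>Weights of sets of walks\<close>

definition weight :: "('b \<Rightarrow> real) \<Rightarrow> 'b list set \<Rightarrow> real" where
  "weight q A = (\<Sum>l\<in>A. prod_list (map q l))"

definition conc :: "'b list set \<Rightarrow> 'b list set \<Rightarrow> 'b list set" where
  "conc A B = (\<lambda>(p, r). p @ r) ` (A \<times> B)"

lemma in_conc_iff: "l \<in> conc A B \<longleftrightarrow> (\<exists>p r. l = p @ r \<and> p \<in> A \<and> r \<in> B)"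
  by (auto simp: conc_def)

lemma edge_probabilities_pos:
  assumes "edge_probabilities C winf q" "e \<in> arcs C"
  shows "0 < q e"
  using assms by (auto simp: edge_probabilities_def)

lemma edge_probabilities_sum:
  assumes "edge_probabilities C winf q" "u \<in> verts C" "u \<noteq> winf"
  shows "(\<Sum>e\<in>out_arcs C u. q e) = 1"
  using assms by (auto simp: edge_probabilities_def positions_def)

context sceg
begin

lemma in_routes_iff: "l \<in> routes C u v \<longleftrightarrow> awalk u l v"
  by (simp add: routes_def)

lemma closed_walk_Nil:
  assumes "awalk u p u"
  shows "p = []"
proof (rule ccontr)
  assume "p \<noteq> []"
  with assms have "closed_w p" by (auto simp: closed_w_def)
  then show False using closed_w_imp_cycle acyclic by blast
qed

text \<open>A repeated vertex would enclose a nonempty closed walk, so every walk is an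
  \<open>apath\<close>, and there are finitely many of those.\<close>

lemma finite_routes: "finite (routes C u v)"
proof -
  have "apath u p v" if "awalk u p v" for p
  proof (rule ccontr)
    assume "\<not> apath u p v"
    then have "\<not> distinct (awalk_verts u p)"
      using that by (simp add: apath_def)
    from awalk_not_distinct_decomp[OF that this]
    obtain r w where "r \<noteq> []" "awalk w r w" by blast
    then show False using closed_walk_Nil by blast
  qed
  then show ?thesis
    using apaths_finite[of u v] by (auto simp: routes_def elim: rev_finite_subset)
qed

lemma routes_same: "v \<in> verts C \<Longrightarrow> routes C v v = {[]}"
  using closed_walk_Nil by (auto simp: routes_def awalk_Nil_iff)

lemma arc_in_routes: "e \<in> arcs C \<Longrightarrow> {[e]} \<subseteq> routes C (tail C e) (head C e)"
  by (simp add: routes_def arc_implies_awalk)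

lemma conc_routes:
  assumes "A \<subseteq> routes C u v" "B \<subseteq> routes C v z"
  shows "conc A B \<subseteq> routes C u z"
  using assms by (auto simp: in_conc_iff in_routes_iff subset_iff)

lemma awalk_prefix_unique:
  assumes "awalk u p v" "awalk u (p @ r) v"
  shows "r = []"
  using assms closed_walk_Nil by auto

text \<open>The split point can be recovered: of two prefixes that both end at \<open>v\<close>, one
  extends the other, and the surplus would be a closed walk. This makes \<open>weight\<close>
  multiplicative on \<open>conc\<close>.\<close>

lemma inj_on_append_routes: "inj_on (\<lambda>(p, r). p @ r) (routes C u v \<times> B)"
proof (rule inj_onI, clarsimp simp: in_routes_iff)
  fix p r p' r'
  assume p: "awalk u p v" "awalk u p' v" and eq: "p @ r = p' @ r'"
  then obtain s where "p = p' @ s \<and> s @ r = r' \<or> p @ s = p' \<and> r = s @ r'"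
    unfolding append_eq_append_conv2 by blast
  then show "p = p' \<and> r = r'"
    using awalk_prefix_unique p by auto
qed

lemma weight_conc:
  assumes "A \<subseteq> routes C u v"
  shows "weight q (conc A B) = weight q A * weight q B"
proof -
  have inj: "inj_on (\<lambda>(p, r). p @ r) (A \<times> B)"
    by (rule inj_on_subset[OF inj_on_append_routes]) (use assms in auto)
  show ?thesis
    unfolding weight_def conc_def sum.reindex[OF inj] sum_product sum.cartesian_product
    by (rule sum.cong) auto
qed

lemma weight_arc: "weight q {[e]} = q e"
  by (simp add: weight_def)

lemma weight_routes_same: "v \<in> verts C \<Longrightarrow> weight q (routes C v v) = 1"
  by (simp add: routes_same weight_def)

lemma weight_routes_pos:
  assumes "edge_probabilities C winf q" "awalk u p v"
  shows "0 < weight q (routes C u v)"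
proof -
  have pos: "0 < prod_list (map q l)" if "set l \<subseteq> arcs C" for l
    using that edge_probabilities_pos[OF assms(1)] by (induction l) auto
  show ?thesis
    unfolding weight_def
    by (rule sum_pos) (use assms(2) pos finite_routes in \<open>auto simp: in_routes_iff\<close>)
qed

text \<open>Splits off the first arc; \<open>u \<noteq> z\<close> rules out the empty walk.\<close>

lemma routes_step:
  assumes "u \<noteq> z"
  shows "routes C u z = (\<Union>e\<in>out_arcs C u. conc {[e]} (routes C (head C e) z))"
proof (rule set_eqI)
  fix l
  show "l \<in> routes C u z \<longleftrightarrow> l \<in> (\<Union>e\<in>out_arcs C u. conc {[e]} (routes C (head C e) z))"
    using assms by (cases l) (auto simp: in_routes_iff in_conc_iff awalk_simps)
qed

lemma weight_routes_step:
  assumes "u \<noteq> z"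
  shows "weight q (routes C u z) =
    (\<Sum>e\<in>out_arcs C u. q e * weight q (routes C (head C e) z))"
proof -
  have "weight q (routes C u z) =
      (\<Sum>e\<in>out_arcs C u. weight q (conc {[e]} (routes C (head C e) z)))"
    unfolding routes_step[OF assms] weight_def
    by (rule sum.UNION_disjoint) (auto simp: in_conc_iff conc_def finite_routes)
  also have "\<dots> = (\<Sum>e\<in>out_arcs C u. q e * weight q (routes C (head C e) z))"
    by (rule sum.cong) (auto simp: weight_arc weight_conc[OF arc_in_routes])
  finally show ?thesis .
qed

text \<open>The measure for inductions along arcs: acyclicity makes it drop strictly on every
  nonempty walk, since the start is no longer reachable.\<close>

definition height :: "'a \<Rightarrow> nat" where
  "height u = card {v. \<exists>p. awalk u p v}"

lemma height_less:
  assumes "awalk u p v" "u \<noteq> v"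
  shows "height v < height u"
  unfolding height_def
proof (rule psubset_card_mono)
  show "finite {w. \<exists>p. awalk u p w}"
    by (rule finite_subset[OF _ finite_verts]) auto
  have "\<exists>r. awalk u r w" if "awalk v p' w" for p' w
    using assms(1) that awalk_appendI by blast
  moreover have "\<not> awalk v r u" for r
    using assms walk_antisym by blast
  moreover have "awalk u [] u"
    using assms(1) by (auto simp: awalk_Nil_iff)
  ultimately show "{w. \<exists>p. awalk v p w} \<subset> {w. \<exists>p. awalk u p w}"
    by blast
qed

lemma arc_no_return:
  assumes "e \<in> arcs C"
  shows "\<not> awalk (head C e) p (tail C e)"
proof
  assume "awalk (head C e) p (tail C e)"
  then have "awalk (tail C e) (e # p) (tail C e)"
    using assms by (simp add: awalk_Cons_iff)
  then show False using closed_walk_Nil by blast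
qed

lemma height_head_less:
  assumes "e \<in> arcs C"
  shows "height (head C e) < height (tail C e)"
  using height_less[OF arc_implies_awalk[OF assms]] arc_no_return[OF assms, of "[]"] assms
  by (auto simp: awalk_Nil_iff)

text \<open>A random walk that follows the arc probabilities reaches the sink almost surely.
  Splitting off the first arc leaves a sum of probabilities at one position.\<close>

lemma weight_routes_sink:
  assumes q: "edge_probabilities C winf q" and "u \<in> verts C"
  shows "weight q (routes C u winf) = 1"
  using assms(2)
proof (induction "height u" arbitrary: u rule: less_induct)
  case less
  show ?case
  proof (cases "u = winf")
    case True
    then show ?thesis using winf_in_verts by (simp add: weight_routes_same)
  next
    case False
    have "weight q (routes C (head C e) winf) = 1" if "e \<in> out_arcs C u" for e
      using less.hyps[of "head C e"] height_head_less[of e] that by auto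
    then show ?thesis
      using False edge_probabilities_sum[OF q less.prems] by (simp add: weight_routes_step)
  qed
qed

section \<open>Routes through prescribed arcs\<close>

lemma awalk_split_arc:
  assumes "awalk u l z" "e \<in> set l"
  obtains p r where "l = p @ e # r" "awalk u p (tail C e)" "awalk (head C e) r z"
proof -
  from assms(2) obtain p r where l: "l = p @ e # r" by (auto simp: in_set_conv_decomp)
  with assms(1) have "awalk u p (tail C e)" "awalk (head C e) r z"
    by (auto simp: awalk_Cons_iff)
  with l show ?thesis by (rule that)
qed

lemma routes_through_arc:
  assumes "e \<in> arcs C"
  shows "{l \<in> routes C u z. e \<in> set l} =
    conc (routes C u (tail C e)) (conc {[e]} (routes C (head C e) z))"
proof (intro set_eqI iffI)
  fix l assume "l \<in> {l \<in> routes C u z. e \<in> set l}"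
  then have "awalk u l z" "e \<in> set l" by (simp_all add: in_routes_iff)
  then obtain p r where "l = p @ e # r" "awalk u p (tail C e)" "awalk (head C e) r z"
    by (rule awalk_split_arc)
  then show "l \<in> conc (routes C u (tail C e)) (conc {[e]} (routes C (head C e) z))"
    by (auto simp: in_routes_iff in_conc_iff)
next
  fix l assume "l \<in> conc (routes C u (tail C e)) (conc {[e]} (routes C (head C e) z))"
  then show "l \<in> {l \<in> routes C u z. e \<in> set l}"
    using assms by (auto simp: in_routes_iff in_conc_iff awalk_Cons_iff)
qed

text \<open>As \<open>tail C f\<close> cannot reach \<open>tail C e\<close>, the arc
  \<open>f\<close> can only come after \<open>e\<close>, so it is sought in the remainder behind
  \<open>e\<close>.\<close>

lemma routes_through_two_arcs:
  assumes "e \<in> arcs C" "f \<in> arcs C" "\<nexists>p. awalk (tail C f) p (tail C e)"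
  shows "{l \<in> routes C u z. e \<in> set l \<and> f \<in> set l} =
    conc (routes C u (tail C e)) (conc {[e]} {l \<in> routes C (head C e) z. f \<in> set l})"
proof (intro set_eqI iffI)
  fix l assume l: "l \<in> {l \<in> routes C u z. e \<in> set l \<and> f \<in> set l}"
  then have "awalk u l z" "e \<in> set l" by (simp_all add: in_routes_iff)
  then obtain p r where p: "l = p @ e # r" "awalk u p (tail C e)" "awalk (head C e) r z"
    by (rule awalk_split_arc)
  have "f \<notin> set p"
  proof
    assume "f \<in> set p"
    with p(2) obtain r' where "awalk (head C f) r' (tail C e)"
      by (rule awalk_split_arc)
    then have "awalk (tail C f) (f # r') (tail C e)"
      using assms(2) by (simp add: awalk_Cons_iff)
    then show False using assms(3) by blast
  qed
  moreover have "awalk (tail C e) [] (tail C e)"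
    using assms(1) by (simp add: awalk_Nil_iff)
  then have "f \<noteq> e" using assms(3) by blast
  ultimately have "f \<in> set r" using l p(1) by auto
  then show "l \<in> conc (routes C u (tail C e)) (conc {[e]} {l \<in> routes C (head C e) z. f \<in> set l})"
    using p by (auto simp: in_routes_iff in_conc_iff)
next
  fix l
  assume "l \<in> conc (routes C u (tail C e)) (conc {[e]} {l \<in> routes C (head C e) z. f \<in> set l})"
  then show "l \<in> {l \<in> routes C u z. e \<in> set l \<and> f \<in> set l}"
    using assms by (auto simp: in_routes_iff in_conc_iff awalk_Cons_iff)
qed

lemma weight_through_arc:
  assumes "edge_probabilities C winf q" "e \<in> arcs C"
  shows "weight q {l \<in> routes C u winf. e \<in> set l} = weight q (routes C u (tail C e)) * q e"
  using assms
  by (simp add: routes_through_arc weight_conc[OF order_refl] weight_conc[OF arc_in_routes]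
      weight_arc weight_routes_sink)

lemma weight_through_two_arcs:
  assumes "edge_probabilities C winf q" "e \<in> arcs C" "f \<in> arcs C"
    and "\<nexists>p. awalk (tail C f) p (tail C e)"
  shows "weight q {l \<in> routes C u winf. e \<in> set l \<and> f \<in> set l} =
    weight q (routes C u (tail C e)) * q e * (weight q (routes C (head C e) (tail C f)) * q f)"
  using assms
  by (simp add: routes_through_two_arcs weight_conc[OF order_refl] weight_conc[OF arc_in_routes]
      weight_arc weight_through_arc)

text \<open>Only arcs whose tails are reachable from \<open>u\<close> occur on walks from
  \<open>u\<close>. Hence probabilities at an unreachable vertex can be changed freely.\<close>

lemma weight_routes_cong:
  assumes "\<And>e p. e \<in> arcs C \<Longrightarrow> awalk u p (tail C e) \<Longrightarrow> q e = q' e"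
  shows "weight q (routes C u z) = weight q' (routes C u z)"
proof -
  have "map q l = map q' l" if "awalk u l z" for l
  proof (rule map_cong[OF refl])
    fix e assume e: "e \<in> set l"
    with that obtain p where "awalk u p (tail C e)" by (rule awalk_split_arc)
    then show "q e = q' e" using assms e that by blast
  qed
  then show ?thesis
    unfolding weight_def by (intro sum.cong) (metis in_routes_iff)+
qed

lemma out_arcs_nonempty: "u \<in> verts C \<Longrightarrow> u \<noteq> winf \<Longrightarrow> out_arcs C u \<noteq> {}"
  using unique_sink by blast

lemma ex_edge_probabilities: "\<exists>q. edge_probabilities C winf q"
proof
  define q :: "'b \<Rightarrow> real" where "q e = 1 / card (out_arcs C (tail C e))" for e
  have "card (out_arcs C (tail C e)) > 0" if "e \<in> arcs C" for e
    using that by (auto simp: card_gt_0_iff)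
  moreover have "(\<Sum>e\<in>out_arcs C u. q e) = 1" if "u \<in> verts C" "u \<noteq> winf" for u
  proof -
    have "(\<Sum>e\<in>out_arcs C u. q e) = (\<Sum>e\<in>out_arcs C u. 1 / card (out_arcs C u))"
      by (rule sum.cong) (auto simp: q_def)
    also have "\<dots> = 1" using out_arcs_nonempty[OF that] by (simp add: finite_out_arcs card_gt_0_iff)
    finally show ?thesis .
  qed
  ultimately show "edge_probabilities C winf q"
    by (auto simp: edge_probabilities_def positions_def q_def)
qed

subsection \<open>Vertices forced by equal weights\<close>

text \<open>The sink is a second target so that a vertex separating the root lies on every route,
  and so that the condition keeps its content when \<open>z\<close> is unreachable from
  \<open>u\<close>.\<close>

definition separates :: "'a \<Rightarrow> 'a \<Rightarrow> 'a \<Rightarrow> bool" where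
  "separates z w u \<longleftrightarrow>
     (\<forall>p t. t \<in> {z, winf} \<longrightarrow> awalk u p t \<longrightarrow> w \<in> set (awalk_verts u p))"

lemma separatesD: "separates z w u \<Longrightarrow> awalk u p t \<Longrightarrow> t \<in> {z, winf} \<Longrightarrow> w \<in> set (awalk_verts u p)"
  by (auto simp: separates_def)

lemma separates_self: "separates z u u"
  by (auto simp: separates_def intro: hd_in_awalk_verts)

text \<open>The vertices separating \<open>b\<close> from \<open>z\<close> and the sink lie on a common route, so they are
  linearly ordered; the witness is the last one.\<close>

lemma last_separator:
  assumes b: "b \<in> verts C"
  obtains w where "separates z w b"
    and "\<And>u v. separates z v b \<Longrightarrow> separates z v u \<Longrightarrow> separates z w u"
proof -
  \<comment> \<open>Height falls along walks, so least height picks the last separator.\<close>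
  obtain w where w: "separates z w b"
    and least: "\<And>v. separates z v b \<Longrightarrow> height w \<le> height v"
    using ex_has_least_nat[of "\<lambda>w. separates z w b" b height] separates_self by blast
  have "separates z w u" if v: "separates z v b" "separates z v u" for u v
    unfolding separates_def
  proof (intro allI impI)
    fix p t assume t: "t \<in> {z, winf}" and p: "awalk u p t"
    obtain q r where qr: "p = q @ r" "awalk u q v" "awalk v r t"
      using awalk_decomp[OF p separatesD[OF v(2) p t]] by blast
    \<comment> \<open>The part of \<open>p\<close> before \<open>v\<close> is exchanged for a walk
      from \<open>b\<close>. On the resulting walk \<open>w\<close> must occur, and if it occurs
      before \<open>v\<close>, minimality gives \<open>w = v\<close>.\<close>
    obtain k where k: "awalk b k winf" using walk_from_root_to_sink(2)[OF b] by blast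
    then obtain s where s: "awalk b s v"
      using awalk_decomp[OF k separatesD[OF v(1) k]] by blast
    have "w \<in> set (awalk_verts b (s @ r))"
      using separatesD[OF w awalk_appendI[OF s qr(3)] t] .
    then consider "w \<in> set (awalk_verts b s)" | "w \<in> set (awalk_verts v r)"
      by (auto simp: set_awalk_verts_append[OF s qr(3)])
    then have "w \<in> set (awalk_verts v r)"
    proof cases
      case 1
      then obtain s' where "awalk w s' v" using awalk_decomp[OF s] by blast
      then have "w = v" using least[OF v(1)] height_less by (metis not_less)
      then show ?thesis using hd_in_awalk_verts(1)[OF qr(3)] by simp
    qed
    then show "w \<in> set (awalk_verts u p)"
      by (simp add: qr(1) set_awalk_verts_append[OF qr(2,3)])
  qed
  with w show ?thesis by (rule that)
qed

text \<open>The weights from \<open>b\<close> and from the heads of the arcs at \<open>a\<close> do not depend on the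
  probabilities at \<open>a\<close>, so moving these halfway towards one arc isolates its contribution.\<close>

lemma weight_head_eq:
  assumes q: "edge_probabilities C winf q"
    and a: "a \<noteq> z" "e0 \<in> out_arcs C a"
    and nob: "\<nexists>p. awalk b p a"
    and eq: "\<And>q. edge_probabilities C winf q \<Longrightarrow>
      weight q (routes C a z) = weight q (routes C b z)"
  shows "weight q (routes C (head C e0) z) = weight q (routes C b z)"
proof -
  \<comment> \<open>The mean of \<open>q\<close> and the point mass on \<open>e0\<close>, at
    \<open>a\<close> only. Unlike the point mass itself it stays strictly positive.\<close>
  define q' where "q' e = (if tail C e = a then (q e + of_bool (e = e0)) / 2 else q e)" for e
  define W where "W u = weight q (routes C u z)" for u
  have dirac: "(\<Sum>e\<in>out_arcs C a. of_bool (e = e0) * f e) = f e0" for f :: "'b \<Rightarrow> real"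
    using a(2)
    by (simp add: of_bool_def if_distrib[of "\<lambda>x. x * _"] finite_out_arcs cong: if_cong)
  have q': "edge_probabilities C winf q'"
    unfolding edge_probabilities_def
  proof (intro conjI ballI)
    fix e assume "e \<in> arcs C"
    then have "0 < q e" using edge_probabilities_pos[OF q] by blast
    then show "0 < q' e" by (auto simp: q'_def)
  next
    fix u assume u: "u \<in> positions C winf"
    then have s: "(\<Sum>e\<in>out_arcs C u. q e) = 1" using q by (auto simp: edge_probabilities_def)
    show "(\<Sum>e\<in>out_arcs C u. q' e) = 1"
    proof (cases "u = a")
      case True
      have "(\<Sum>e\<in>out_arcs C a. q' e) = (\<Sum>e\<in>out_arcs C a. (q e + of_bool (e = e0)) / 2)"
        by (rule sum.cong) (auto simp: q'_def)
      also have "\<dots> = 1"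
        using s True dirac[of "\<lambda>_. 1"] by (simp add: sum_divide_distrib[symmetric] sum.distrib)
      finally show ?thesis using True by simp
    next
      case False
      then have "(\<Sum>e\<in>out_arcs C u. q' e) = (\<Sum>e\<in>out_arcs C u. q e)"
        by (intro sum.cong) (auto simp: q'_def)
      then show ?thesis using s by simp
    qed
  qed
  have same: "weight q' (routes C u z) = W u" if "\<nexists>p. awalk u p a" for u
    unfolding W_def by (rule weight_routes_cong) (use that in \<open>auto simp: q'_def\<close>)
  \<comment> \<open>The hypothesis under \<open>q'\<close> becomes
    \<open>W b = (W a + W (head C e0)) / 2\<close>, and under \<open>q\<close> it says
    \<open>W a = W b\<close>.\<close>
  have "W b = weight q' (routes C a z)"
    using eq[OF q'] same[OF nob] by simp
  also have "\<dots> = (\<Sum>e\<in>out_arcs C a. q' e * W (head C e))"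
    unfolding weight_routes_step[OF a(1)]
    by (rule sum.cong) (use same arc_no_return in auto)
  also have "\<dots> = (\<Sum>e\<in>out_arcs C a. (q e * W (head C e) + of_bool (e = e0) * W (head C e)) / 2)"
    by (rule sum.cong) (auto simp: q'_def field_simps)
  also have "\<dots> = (W a + W (head C e0)) / 2"
    by (simp add: sum_divide_distrib[symmetric] sum.distrib dirac W_def weight_routes_step[OF a(1)])
  also have "W a = W b" using eq[OF q] by (simp add: W_def)
  finally show ?thesis by (simp add: W_def field_simps)
qed

text \<open>Induction on the sum of heights. Distinct vertices cannot reach each other both ways, so
  one of them can be replaced by its successors; equal vertices separate themselves.\<close>

lemma weights_eq_imp_separator:
  assumes "a \<in> verts C" "b \<in> verts C" "z \<in> verts C"
    and "\<And>q. edge_probabilities C winf q \<Longrightarrow>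
      weight q (routes C a z) = weight q (routes C b z)"
  shows "\<exists>w. separates z w a \<and> separates z w b"
  using assms
proof (induction "height a + height b" arbitrary: a b rule: less_induct)
  case less
  note z = \<open>z \<in> verts C\<close>
  \<comment> \<open>Here \<open>a'\<close> is the vertex to be expanded; naming the pair afresh
    handles both orders of \<open>a\<close> and \<open>b\<close> at once.\<close>
  have expand: "\<exists>w. separates z w a' \<and> separates z w b'"
    if ab: "{a', b'} = {a, b}" "a' \<noteq> b'" and nob: "\<nexists>p. awalk b' p a'" for a' b'
  proof -
    have sum: "height a' + height b' = height a + height b"
      and verts: "a' \<in> verts C" "b' \<in> verts C"
      using ab less.prems by (auto simp: doubleton_eq_iff)
    have eq: "weight q (routes C a' z) = weight q (routes C b' z)"
      if "edge_probabilities C winf q" for q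
      using ab less.prems(4)[OF that] by (auto simp: doubleton_eq_iff)
    have "a' \<noteq> winf"
      using nob walk_from_root_to_sink(2)[OF verts(2)] by blast
    \<comment> \<open>Otherwise the weight from \<open>a'\<close> is one, by the empty walk, while
      the weight from \<open>b'\<close> is an empty sum.\<close>
    have "a' \<noteq> z"
    proof
      assume "a' = z"
      obtain q where q: "edge_probabilities C winf q" using ex_edge_probabilities by blast
      have "routes C b' z = {}" using nob \<open>a' = z\<close> by (auto simp: in_routes_iff)
      then show False
        using eq[OF q] z \<open>a' = z\<close> by (simp add: weight_routes_same) (simp add: weight_def)
    qed
    \<comment> \<open>Chosen before any arc is fixed: the induction hypothesis gives a separator
      \<open>v\<close> that may vary with the arc, and \<open>last\<close> trades each for this
      \<open>w\<close>.\<close>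
    obtain w where w: "separates z w b'"
      and last: "\<And>u v. separates z v b' \<Longrightarrow> separates z v u \<Longrightarrow> separates z w u"
      using last_separator[OF verts(2)] by blast
    have head: "separates z w (head C e)" if e: "e \<in> out_arcs C a'" for e
    proof -
      have "\<exists>v. separates z v (head C e) \<and> separates z v b'"
      proof (rule less.hyps)
        show "height (head C e) + height b' < height a + height b"
          using height_head_less[of e] e sum[symmetric] by auto
        show "weight q (routes C (head C e) z) = weight q (routes C b' z)"
          if "edge_probabilities C winf q" for q
          using weight_head_eq[OF that \<open>a' \<noteq> z\<close> e nob eq] .
      qed (use e verts z in auto)
      then show ?thesis using last by blast
    qed
    have "separates z w a'"
      unfolding separates_def
    proof (intro allI impI)
      fix p t assume t: "t \<in> {z, winf}" and p: "awalk a' p t"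
      with \<open>a' \<noteq> z\<close> \<open>a' \<noteq> winf\<close> obtain e r where er: "p = e # r"
        by (cases p) (auto simp: awalk_Nil_iff)
      then have "e \<in> out_arcs C a'" "awalk (head C e) r t" using p by (auto simp: awalk_Cons_iff)
      then show "w \<in> set (awalk_verts a' p)"
        using separatesD[OF head _ t] er by auto
    qed
    with w show ?thesis by blast
  qed
  show ?case
  proof (cases "a = b")
    case True
    then show ?thesis using separates_self by blast
  next
    case False
    then have "(\<nexists>p. awalk b p a) \<or> (\<nexists>p. awalk a p b)"
      using walk_antisym by blast
    then show ?thesis
      using expand[of a b] expand[of b a] False by (auto simp: insert_commute)
  qed
qed

subsection \<open>Route probabilities and position variables\<close>

lemma compatible_prob:
  assumes "set_pmf P \<subseteq> routes C w0 winf"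
    and "\<And>l. l \<in> routes C w0 winf \<Longrightarrow> pmf P l = prod_list (map q l)"
  shows "measure_pmf.prob P {l. Q l} = weight q {l \<in> routes C w0 winf. Q l}"
proof -
  have "measure_pmf.prob P {l. Q l} = measure_pmf.prob P {l \<in> routes C w0 winf. Q l}"
    by (rule measure_prob_cong_0) (use assms(1) in \<open>auto simp: set_pmf_iff\<close>)
  also have "\<dots> = sum (pmf P) {l \<in> routes C w0 winf. Q l}"
    by (rule measure_measure_pmf_finite) (simp add: finite_routes)
  also have "\<dots> = weight q {l \<in> routes C w0 winf. Q l}"
    unfolding weight_def by (rule sum.cong) (use assms(2) in auto)
  finally show ?thesis .
qed

text \<open>Independence speaks of distributions, the weight argument of edge probabilities; this
  passes from the latter to the former. Total mass one is \<open>weight_routes_sink\<close> at the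
  root.\<close>

lemma ex_compatible:
  assumes q: "edge_probabilities C winf q"
  obtains P where "compatible_with C w0 winf P"
    and "\<And>Q. measure_pmf.prob P {l. Q l} = weight q {l \<in> routes C w0 winf. Q l}"
proof -
  define p where "p l = (if l \<in> routes C w0 winf then prod_list (map q l) else 0)" for l
  have nonneg: "0 \<le> p l" for l
  proof -
    have "0 \<le> prod_list (map q l)" if "set l \<subseteq> arcs C"
      using that edge_probabilities_pos[OF q]
      by (induction l) (auto intro: less_imp_le mult_nonneg_nonneg)
    then show ?thesis by (auto simp: p_def in_routes_iff)
  qed
  have "(\<integral>\<^sup>+l. ennreal (p l) \<partial>count_space UNIV) =
      (\<integral>\<^sup>+l. ennreal (p l) \<partial>count_space (routes C w0 winf))"
    by (rule nn_integral_count_space_eq) (auto simp: p_def)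
  also have "\<dots> = ennreal (\<Sum>l\<in>routes C w0 winf. p l)"
    by (simp add: nn_integral_count_space_finite finite_routes sum_ennreal nonneg)
  also have "(\<Sum>l\<in>routes C w0 winf. p l) = 1"
    using weight_routes_sink[OF q w0_in_verts] by (simp add: weight_def p_def)
  finally have total: "(\<integral>\<^sup>+l. ennreal (p l) \<partial>count_space UNIV) = 1" by simp
  define P where "P = embed_pmf p"
  have "pmf P l = p l" for l
    unfolding P_def by (rule pmf_embed_pmf[OF nonneg total])
  then have P: "set_pmf P \<subseteq> routes C w0 winf"
      "\<And>l. l \<in> routes C w0 winf \<Longrightarrow> pmf P l = prod_list (map q l)"
    by (auto simp: set_pmf_iff p_def split: if_splits)
  show ?thesis
    by (rule that[OF _ compatible_prob[OF P]])
      (use P q in \<open>auto simp: compatible_with_def\<close>)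
qed

section \<open>Precedence as reachability\<close>

lemma awalk_verts_nth_append:
  assumes "awalk u p v"
  shows "awalk_verts u (p @ q) ! length p = awhd v q"
  using assms
  by (induction p arbitrary: u) (auto simp: awalk_simps hd_conv_nth)

lemma awalk_between_nth:
  assumes "awalk u l z" "i < j" "j < length (awalk_verts u l)"
  shows "\<exists>p. p \<noteq> [] \<and> awalk (awalk_verts u l ! i) p (awalk_verts u l ! j)"
  using assms
proof (induction l arbitrary: u i j)
  case (Cons e l)
  have e: "e \<in> arcs C" "tail C e = u" and l: "awalk (head C e) l z"
    using Cons.prems(1) by (auto simp: awalk_Cons_iff)
  obtain j' where j: "j = Suc j'" "j' < length (awalk_verts (head C e) l)"
    using Cons.prems(2,3) by (cases j) auto
  show ?case
  proof (cases i)
    case 0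
    have "awalk_verts (head C e) l ! j' \<in> set (awalk_verts (head C e) l)"
      using j(2) by simp
    then obtain p where "awalk (head C e) p (awalk_verts (head C e) l ! j')"
      using awalk_decomp[OF l] by blast
    then have "awalk u (e # p) (awalk_verts (head C e) l ! j')"
      using e by (simp add: awalk_Cons_iff)
    then show ?thesis using 0 j e by auto
  next
    case (Suc i')
    then show ?thesis using Cons.IH[OF l, of i' j'] Cons.prems(2) j by auto
  qed
qed simp

lemma precedes_iff: "precedes C w0 winf u v \<longleftrightarrow> u \<noteq> v \<and> (\<exists>p. awalk u p v)"
proof
  assume "precedes C w0 winf u v"
  then obtain l i j where "awalk w0 l winf" "i < j" "j < length (awalk_verts w0 l)"
      "awalk_verts w0 l ! i = u" "awalk_verts w0 l ! j = v"
    by (auto simp: precedes_def in_routes_iff)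
  then obtain p where "p \<noteq> []" "awalk u p v"
    using awalk_between_nth by blast
  then show "u \<noteq> v \<and> (\<exists>p. awalk u p v)"
    using closed_walk_Nil by blast
next
  assume "u \<noteq> v \<and> (\<exists>p. awalk u p v)"
  then obtain p where uv: "u \<noteq> v" and p: "awalk u p v" by blast
  obtain s where s: "awalk w0 s u"
    using walk_from_root_to_sink(1) awalk_hd_in_verts[OF p] by blast
  obtain r where r: "awalk v r winf"
    using walk_from_root_to_sink(2) awalk_last_in_verts[OF p] by blast
  have pr: "awalk u (p @ r) winf" using p r by (rule awalk_appendI)
  have spr: "awalk w0 (s @ p @ r) winf" using s pr by (rule awalk_appendI)
  have "p \<noteq> []" using uv p by (auto simp: awalk_Nil_iff)
  \<comment> \<open>A vertex list has one more entry than its arc list, so the end of a prefix sits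
    at the index given by the prefix length.\<close>
  have "awalk_verts w0 (s @ p @ r) ! length s = u"
    using awalk_verts_nth_append[OF s, of "p @ r"] awhd_of_awalk[OF pr] by simp
  moreover have "awalk_verts w0 (s @ p @ r) ! length (s @ p) = v"
    using awalk_verts_nth_append[OF awalk_appendI[OF s p], of r] awhd_of_awalk[OF r] by simp
  moreover have "length s < length (s @ p)" "length (s @ p) < length (awalk_verts w0 (s @ p @ r))"
    using \<open>p \<noteq> []\<close> by (auto simp: length_awalk_verts)
  ultimately show "precedes C w0 winf u v"
    unfolding precedes_def using spr in_routes_iff by blast
qed

text \<open>Leaving a vertex twice would require returning to it. This justifies the
  \<open>THE\<close> in \<open>position_var\<close>.\<close>

lemma unique_out_arc:
  assumes l: "awalk u l z" and "e \<in> set l" "f \<in> set l" "tail C e = tail C f"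
  shows "e = f"
proof (rule ccontr)
  assume "e \<noteq> f"
  obtain p r where p: "l = p @ e # r" "awalk u p (tail C e)" "awalk (head C e) r z"
    using awalk_split_arc[OF l \<open>e \<in> set l\<close>] .
  have arcs: "e \<in> arcs C" "f \<in> arcs C" using l assms(2,3) by auto
  from \<open>e \<noteq> f\<close> \<open>f \<in> set l\<close> p(1) consider "f \<in> set p" | "f \<in> set r" by auto
  then show False
  proof cases
    case 1
    with p(2) obtain s where "awalk (head C f) s (tail C e)" by (rule awalk_split_arc)
    then show False using arc_no_return[OF arcs(2)] assms(4) by simp
  next
    case 2
    with p(3) obtain s where "awalk (head C e) s (tail C f)" by (rule awalk_split_arc)
    then show False using arc_no_return[OF arcs(1)] assms(4) by simp
  qed
qed

text \<open>Positive labels differ from the value 0 taken off \<open>w\<close>, and injectivity of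
  \<open>lab\<close> at \<open>w\<close> recovers the arc.\<close>

lemma position_var_eq_label_iff:
  assumes lab: "edge_labelling C winf lab"
    and w: "w \<in> positions C winf" and e: "e \<in> out_arcs C w"
    and l: "l \<in> routes C w0 winf"
  shows "position_var C w0 lab w l = lab e \<longleftrightarrow> e \<in> set l"
proof -
  have walk: "awalk w0 l winf" using l by (simp add: in_routes_iff)
  have the_arc: "(THE f. f \<in> out_arcs C w \<and> f \<in> set l) = f"
    if "f \<in> out_arcs C w" "f \<in> set l" for f
    by (rule the_equality) (use that unique_out_arc[OF walk] in auto)
  show ?thesis
  proof
    assume "e \<in> set l"
    moreover have "on_route C w0 w l"
      unfolding on_route_def using awalk_verts_arc1[OF \<open>e \<in> set l\<close>] e by auto
    ultimately show "position_var C w0 lab w l = lab e"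
      using the_arc[OF e] by (simp add: position_var_def)
  next
    assume eq: "position_var C w0 lab w l = lab e"
    have "0 < lab e" using lab w e unfolding edge_labelling_def by blast
    with eq have on: "on_route C w0 w l"
      by (simp add: position_var_def split: if_splits)
    then obtain r where r: "awalk w r winf" "set r \<subseteq> set l"
      using awalk_decomp[OF walk] by (fastforce simp: on_route_def)
    with w obtain f r' where "r = f # r'"
      by (cases r) (auto simp: positions_def awalk_Nil_iff)
    with r have f: "f \<in> out_arcs C w" "f \<in> set l" by (auto simp: awalk_Cons_iff)
    then have "lab f = lab e"
      using eq on the_arc[OF f] by (simp add: position_var_def)
    then have "f = e"
      using lab w e f(1) unfolding edge_labelling_def by (blast dest: inj_onD)
    then show "e \<in> set l" using f(2) by simp
  qed
qed

subsection \<open>Independence and cut-vertices\<close>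

text \<open>For any arc \<open>f\<close> out of \<open>w2\<close>, both sides of the product formula
  share the positive factors \<open>weight q (routes C w0 w1)\<close>, \<open>q e\<close> and
  \<open>q f\<close>, which cancel.\<close>

lemma indep_imp_weight_eq:
  assumes lab: "edge_labelling C winf lab"
    and w1: "w1 \<in> positions C winf" and w2: "w2 \<in> positions C winf"
    and no_return: "\<nexists>p. awalk w2 p w1"
    and indep: "indep C w0 winf (position_var C w0 lab w1) (position_var C w0 lab w2)"
    and e: "e \<in> out_arcs C w1" and q: "edge_probabilities C winf q"
  shows "weight q (routes C (head C e) w2) = weight q (routes C w0 w2)"
proof -
  have verts: "w1 \<in> verts C" "w2 \<in> verts C" "w2 \<noteq> winf"
    using w1 w2 by (auto simp: positions_def)
  obtain f where f: "f \<in> out_arcs C w2" using out_arcs_nonempty[OF verts(2,3)] by blast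
  obtain P where P: "compatible_with C w0 winf P"
    and prob: "\<And>Q. measure_pmf.prob P {l. Q l} = weight q {l \<in> routes C w0 winf. Q l}"
    using ex_compatible[OF q] by blast
  let ?X = "position_var C w0 lab w1" and ?Y = "position_var C w0 lab w2"
  have [simp]: "l \<in> routes C w0 winf \<and> ?X l = lab e \<longleftrightarrow> l \<in> routes C w0 winf \<and> e \<in> set l"
    "l \<in> routes C w0 winf \<and> ?Y l = lab f \<longleftrightarrow> l \<in> routes C w0 winf \<and> f \<in> set l"
    "l \<in> routes C w0 winf \<and> ?X l = lab e \<and> ?Y l = lab f \<longleftrightarrow>
      l \<in> routes C w0 winf \<and> e \<in> set l \<and> f \<in> set l" for l
    using position_var_eq_label_iff[OF lab w1 e] position_var_eq_label_iff[OF lab w2 f] by auto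
  have product: "measure_pmf.prob P {l. ?X l = lab e \<and> ?Y l = lab f} =
      measure_pmf.prob P {l. ?X l = lab e} * measure_pmf.prob P {l. ?Y l = lab f}"
    using indep P by (simp add: indep_def)
  have ef: "e \<in> arcs C" "tail C e = w1" "f \<in> arcs C" "tail C f = w2" using e f by auto
  have "weight q (routes C w0 w1) * q e * (weight q (routes C (head C e) w2) * q f) =
      weight q (routes C w0 w1) * q e * (weight q (routes C w0 w2) * q f)"
    using product weight_through_arc[OF q ef(1), of w0] weight_through_arc[OF q ef(3), of w0]
      weight_through_two_arcs[OF q ef(1,3), of w0] no_return
    by (simp add: prob ef)
  moreover have "0 < q e" "0 < q f" using edge_probabilities_pos[OF q] ef by auto
  moreover have "0 < weight q (routes C w0 w1)"
    using weight_routes_pos[OF q] walk_from_root_to_sink(1)[OF verts(1)] by blast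
  ultimately show ?thesis by simp
qed

text \<open>Separating the root makes \<open>w\<close> a cut-vertex that reaches \<open>w2\<close>;
  separating \<open>head C e\<close> puts it strictly after \<open>w1\<close>. The walk
  \<open>r\<close> may be empty, which is the case that \<open>w2\<close> itself is the
  cut-vertex.\<close>

lemma indep_imp_cut_vertex:
  assumes lab: "edge_labelling C winf lab"
    and w1: "w1 \<in> positions C winf" and w2: "w2 \<in> positions C winf"
    and no_return: "\<nexists>p. awalk w2 p w1"
    and indep: "indep C w0 winf (position_var C w0 lab w1) (position_var C w0 lab w2)"
  shows "\<exists>w p r. cut_vertex C winf w \<and> w1 \<noteq> w \<and> awalk w1 p w \<and> awalk w r w2"
proof -
  have verts: "w1 \<in> verts C" "w1 \<noteq> winf" "w2 \<in> verts C" "w2 \<noteq> winf"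
    using w1 w2 by (auto simp: positions_def)
  obtain e where e: "e \<in> out_arcs C w1" using out_arcs_nonempty[OF verts(1,2)] by blast
  then have arc: "e \<in> arcs C" "tail C e = w1" by auto
  then have head: "head C e \<in> verts C" by simp
  obtain w where w: "separates w2 w (head C e)" "separates w2 w w0"
    using weights_eq_imp_separator[OF head w0_in_verts verts(3)]
      indep_imp_weight_eq[OF lab w1 w2 no_return indep e] by blast
  obtain k where k: "awalk (head C e) k winf" using walk_from_root_to_sink(2)[OF head] by blast
  then obtain p where p: "awalk (head C e) p w"
    using awalk_decomp[OF k separatesD[OF w(1) k]] by blast
  then have w1w: "awalk w1 (e # p) w" using arc by (simp add: awalk_Cons_iff)
  then have "w1 \<noteq> w" using closed_walk_Nil by blast
  obtain m where m: "awalk w0 m w2" using walk_from_root_to_sink(1)[OF verts(3)] by blast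
  then obtain r where r: "awalk w r w2"
    using awalk_decomp[OF m separatesD[OF w(2) m]] by blast
  have "w \<noteq> w0"
    using w1w \<open>w1 \<noteq> w\<close> walk_from_root_to_sink(1)[OF verts(1)] walk_antisym by blast
  moreover have "w \<noteq> winf"
    using r verts(4) walk_from_root_to_sink(2)[OF verts(3)] walk_antisym by blast
  moreover have "on_route C w0 w l" if "l \<in> routes C w0 winf" for l
    using separatesD[OF w(2)] that by (auto simp: on_route_def in_routes_iff)
  ultimately have "cut_vertex C winf w"
    using awalk_hd_in_verts[OF r] by (auto simp: cut_vertex_iff_on_all_routes positions_def)
  then show ?thesis using \<open>w1 \<noteq> w\<close> w1w r by blast
qed

section \<open>From cut-vertices to independence\<close>

lemma routes_through_cut_vertex:
  assumes "cut_vertex C winf w"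
  shows "routes C w0 winf = conc (routes C w0 w) (routes C w winf)"
proof
  show "routes C w0 winf \<subseteq> conc (routes C w0 w) (routes C w winf)"
  proof
    fix l assume "l \<in> routes C w0 winf"
    moreover from this have "w \<in> set (awalk_verts w0 l)"
      using assms by (auto simp: cut_vertex_iff_on_all_routes on_route_def)
    ultimately show "l \<in> conc (routes C w0 w) (routes C w winf)"
      using awalk_decomp by (fastforce simp: in_conc_iff in_routes_iff)
  qed
qed (rule conc_routes[OF order_refl order_refl])

text \<open>By acyclicity a vertex strictly before \<open>w\<close> does not recur behind
  \<open>w\<close>.\<close>

lemma position_var_prefix:
  assumes "awalk u p w" "awalk w r z" "awalk v s w" "v \<noteq> w"
  shows "position_var C u lab v (p @ r) = position_var C u lab v p"
proof -
  have notin: "v \<notin> set (awalk_verts w r)"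
    using awalk_decomp[OF assms(2), of v] assms(3,4) walk_antisym by blast
  then have "on_route C u v (p @ r) \<longleftrightarrow> on_route C u v p"
    by (simp add: on_route_def set_awalk_verts_append[OF assms(1,2)])
  moreover have "e \<in> out_arcs C v \<and> e \<in> set (p @ r) \<longleftrightarrow> e \<in> out_arcs C v \<and> e \<in> set p" for e
    using notin awalk_verts_arc1[of e r w] by auto
  ultimately show ?thesis by (simp only: position_var_def)
qed

text \<open>Here \<open>v = w\<close> is allowed: then \<open>v\<close> ends \<open>p\<close> but
  also starts \<open>r\<close>, and the arc leaving it belongs to \<open>r\<close>.\<close>

lemma position_var_suffix:
  assumes "awalk u p w" "awalk w r z" "awalk w s v"
  shows "position_var C u lab v (p @ r) = position_var C w lab v r"
proof -
  have "v \<in> set (awalk_verts w r)" if "v \<in> set (awalk_verts u p)"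
  proof -
    from awalk_decomp[OF assms(1) that] obtain k where "awalk v k w" by blast
    then have "v = w" using assms(3) walk_antisym by blast
    then show ?thesis using hd_in_awalk_verts(1)[OF assms(2)] by simp
  qed
  then have "on_route C u v (p @ r) \<longleftrightarrow> on_route C w v r"
    by (auto simp: on_route_def set_awalk_verts_append[OF assms(1,2)])
  moreover have "e \<notin> set p" if e: "e \<in> out_arcs C v" for e
  proof
    assume "e \<in> set p"
    with assms(1) obtain k where "awalk (head C e) k w" by (rule awalk_split_arc)
    then have "awalk (head C e) (k @ s) v" using assms(3) by (rule awalk_appendI)
    moreover have "e \<in> arcs C" "tail C e = v" using e by auto
    ultimately show False using arc_no_return by blast
  qed
  then have "e \<in> out_arcs C v \<and> e \<in> set (p @ r) \<longleftrightarrow> e \<in> out_arcs C v \<and> e \<in> set r" for e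
    by auto
  ultimately show ?thesis by (simp only: position_var_def)
qed

lemma cut_vertex_imp_indep:
  assumes cut: "cut_vertex C winf w"
    and w1: "awalk w1 s1 w" "w1 \<noteq> w" and w2: "awalk w s2 w2"
  shows "indep C w0 winf (position_var C w0 lab w1) (position_var C w0 lab w2)"
  unfolding indep_def
proof (intro allI impI)
  fix P x y assume "compatible_with C w0 winf P"
  then obtain q where q: "edge_probabilities C winf q" and P: "set_pmf P \<subseteq> routes C w0 winf"
      "\<And>l. l \<in> routes C w0 winf \<Longrightarrow> pmf P l = prod_list (map q l)"
    by (auto simp: compatible_with_def)
  let ?X = "position_var C w0 lab w1" and ?Y = "position_var C w0 lab w2"
    and ?Y' = "position_var C w lab w2"
  note routes = routes_through_cut_vertex[OF cut]
  have [simp]: "?X (p @ r) = ?X p" "?Y (p @ r) = ?Y' r"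
    if "p \<in> routes C w0 w" "r \<in> routes C w winf" for p r
    using that position_var_prefix[OF _ _ w1] position_var_suffix[OF _ _ w2]
    by (auto simp: in_routes_iff)
  from w2 have w: "w \<in> verts C" by (rule awalk_hd_in_verts)
  \<comment> \<open>Arbitrary predicates yield the joint law and, with one of them constantly true,
    both marginals.\<close>
  have factor: "measure_pmf.prob P {l. A (?X l) \<and> B (?Y l)} =
      weight q {p \<in> routes C w0 w. A (?X p)} * weight q {r \<in> routes C w winf. B (?Y' r)}" for A B
  proof -
    have "{l \<in> routes C w0 winf. A (?X l) \<and> B (?Y l)} =
        conc {p \<in> routes C w0 w. A (?X p)} {r \<in> routes C w winf. B (?Y' r)}"
      unfolding routes by (auto simp: in_conc_iff) blast+
    then show ?thesis
      by (simp add: compatible_prob[OF P] weight_conc[of _ w0 w])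
  qed
  have sink: "weight q (routes C w winf) = 1" using weight_routes_sink[OF q w] .
  \<comment> \<open>The total mass one is the product of the weights before and after
    \<open>w\<close>, and the latter is one.\<close>
  then have root: "weight q (routes C w0 w) = 1"
    using weight_routes_sink[OF q w0_in_verts] weight_conc[OF order_refl, of q w0 w]
    by (simp add: routes)
  show "measure_pmf.prob P {l. ?X l = x \<and> ?Y l = y} =
      measure_pmf.prob P {l. ?X l = x} * measure_pmf.prob P {l. ?Y l = y}"
    using factor[of "\<lambda>a. a = x" "\<lambda>b. b = y"] factor[of "\<lambda>a. a = x" "\<lambda>_. True"]
      factor[of "\<lambda>_. True" "\<lambda>b. b = y"] sink root by simp
qed

end

theorem theorem2:
  fixes C :: "('a,'b) pre_digraph"
    and w0 winf w1 w2 :: 'a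
    and lab :: "'b \<Rightarrow> nat"
  assumes "sceg C w0 winf"
    and "edge_labelling C winf lab"
    and "w1 \<in> positions C winf" and "w2 \<in> positions C winf"
    and "w1 \<noteq> w2"
    and "\<not> precedes C w0 winf w2 w1"
  shows "indep C w0 winf (position_var C w0 lab w1) (position_var C w0 lab w2) \<longleftrightarrow>
     (\<exists>w. cut_vertex C winf w \<and> precedes C w0 winf w1 w \<and> precedes C w0 winf w w2) \<or>
     cut_vertex C winf w2"
proof -
  interpret sceg C w0 winf by fact
  have "w2 \<in> verts C" using \<open>w2 \<in> positions C winf\<close> by (simp add: positions_def)
  then have refl: "awalk w2 [] w2" by (simp add: awalk_Nil_iff)
  \<comment> \<open>\<open>precedes\<close> is strict; \<open>w1 \<noteq> w2\<close> excludes the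
    empty walk as well.\<close>
  have no_return: "\<nexists>p. awalk w2 p w1"
    using \<open>w1 \<noteq> w2\<close> \<open>\<not> precedes C w0 winf w2 w1\<close> by (auto simp: precedes_iff)
  \<comment> \<open>A route through \<open>w1\<close> also meets the cut-vertex \<open>w2\<close>,
    and by \<open>no_return\<close> not before \<open>w1\<close>. So alternative (ii) is the case
    \<open>w = w2\<close> with an empty second walk.\<close>
  have before: "\<exists>p. awalk w1 p w2" if "cut_vertex C winf w2"
  proof -
    obtain l where l: "awalk w0 l winf" "w1 \<in> set (awalk_verts w0 l)"
      using vert_on_route[of w1] \<open>w1 \<in> positions C winf\<close>
      by (auto simp: positions_def on_route_def in_routes_iff)
    obtain p r where pr: "l = p @ r" "awalk w0 p w1" "awalk w1 r winf"
      using awalk_decomp[OF l] by blast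
    have "w2 \<in> set (awalk_verts w0 l)"
      using that l(1) by (auto simp: cut_vertex_iff_on_all_routes on_route_def in_routes_iff)
    then have "w2 \<in> set (awalk_verts w1 r)"
      using awalk_decomp[OF pr(2)] no_return by (auto simp: pr(1) set_awalk_verts_append[OF pr(2,3)])
    then show ?thesis using awalk_decomp[OF pr(3)] by blast
  qed
  show ?thesis (is "?indep \<longleftrightarrow> ?cut")
  proof
    assume ?indep
    then obtain w p r where w: "cut_vertex C winf w" "w1 \<noteq> w" "awalk w1 p w" "awalk w r w2"
      using indep_imp_cut_vertex[OF assms(2-4) no_return] by blast
    then show ?cut by (cases "w = w2") (auto simp: precedes_iff)
  next
    assume ?cut
    then obtain w p r where "cut_vertex C winf w" "awalk w1 p w" "w1 \<noteq> w" "awalk w r w2"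
      using before refl \<open>w1 \<noteq> w2\<close> unfolding precedes_iff by blast
    then show ?indep by (rule cut_vertex_imp_indep)
  qed
qed

end
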